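(* Let $\mathbb{H}$ be a complex Hilbert space and let $A\in\mathbb{B}(\mathbb{H})$. Then \[\|\Re A\|\le \int_0^1\omega\big((1-t)A+tA^*\big)\,dt\le \omega(A).\]
   Context: $\mathbb{B}(\mathbb{H})$ denotes the $C^*$-algebra of all bounded linear operators on $\mathbb{H}$, $\|\cdot\|$ is the operator norm, $A^*$ is the adjoint of $A$, and $\Re A=\frac{A+A^*}{2}$ is the real part of $A$. The numerical radius of an operator $X$ on a complex Hilbert space is $\omega(X)=\sup_{\|x\|=1}|\langle Xx,x\rangle|$. *)

theory Defs
  imports "HOL-Analysis.Analysis"
begin

text \<open>
  HOL-Analysis has no complex inner product spaces. We add a complex scalar multiplication and
  a sesquilinear form, linear in the first argument, to the class \<^class>\<open>real_inner\<close>. The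
  underlying real inner product is the real part of the complex one, so that
  \<open>norm x ^ 2 = Re (cinner x x)\<close>, and positive definiteness, the norm and its topology
  are those inherited from \<^class>\<open>real_inner\<close>.
\<close>

class complex_inner = real_inner +
  fixes scaleC :: "complex \<Rightarrow> 'a \<Rightarrow> 'a"  (infixr "*\<^sub>C" 75)
    and cinner :: "'a \<Rightarrow> 'a \<Rightarrow> complex"
  assumes scaleC_add_right: "c *\<^sub>C (x + y) = c *\<^sub>C x + c *\<^sub>C y"
    and scaleC_add_left: "(c + d) *\<^sub>C x = c *\<^sub>C x + d *\<^sub>C x"
    and scaleC_scaleC: "c *\<^sub>C (d *\<^sub>C x) = (c * d) *\<^sub>C x"
    and scaleC_of_real: "complex_of_real r *\<^sub>C x = r *\<^sub>R x"
    and cinner_commute: "cinner x y = cnj (cinner y x)"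
    and cinner_add_left: "cinner (x + y) z = cinner x z + cinner y z"
    and cinner_scaleC_left: "cinner (c *\<^sub>C x) y = c * cinner x y"
    and inner_eq_Re_cinner: "inner x y = Re (cinner x y)"

class chilbert_space = complex_inner + complete_space

instantiation complex :: chilbert_space
begin

definition "scaleC_complex (c::complex) (x::complex) = c * x"
definition "cinner_complex (x::complex) (y::complex) = x * cnj y"

instance
  by standard
    (auto simp: scaleC_complex_def cinner_complex_def algebra_simps scaleR_conv_of_real
      inner_complex_def)

end

locale bounded_clinear = bounded_linear A
  for A :: "'a::complex_inner \<Rightarrow> 'b::complex_inner" +
  assumes scaleC: "A (c *\<^sub>C x) = c *\<^sub>C A x"

text \<open>
  Existence and uniqueness of the adjoint of a bounded operator on a Hilbert space are
  proved in \<open>cadjoint_exists1\<close> below.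
\<close>

definition cadjoint :: "('a::complex_inner \<Rightarrow> 'a) \<Rightarrow> 'a \<Rightarrow> 'a" where
  "cadjoint A = (THE B. \<forall>x y. cinner (A x) y = cinner x (B y))"

definition real_part :: "('a::complex_inner \<Rightarrow> 'a) \<Rightarrow> 'a \<Rightarrow> 'a" where
  "real_part A = (\<lambda>x. (1 / 2) *\<^sub>R (A x + cadjoint A x))"

text \<open>
  The supremum is taken in the non-negative reals: inserting \<open>0\<close> only matters on the zero
  space, which has no unit vectors, and where \<^const>\<open>Sup\<close> of the empty set of reals would
  be unspecified.
\<close>

definition numerical_radius :: "('a::complex_inner \<Rightarrow> 'a) \<Rightarrow> real" where
  "numerical_radius X = Sup (insert 0 {cmod (cinner (X x) x) | x. norm x = 1})"


lemma cinner_add_right: "cinner x (y + z) = cinner x y + cinner x (z::'a::complex_inner)"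
  by (metis cinner_add_left cinner_commute complex_cnj_add)

lemma cinner_scaleC_right: "cinner x (c *\<^sub>C y) = cnj c * cinner x (y::'a::complex_inner)"
  by (metis cinner_scaleC_left cinner_commute complex_cnj_mult)

lemma cinner_scaleR_left: "cinner (r *\<^sub>R x) y = of_real r * cinner x (y::'a::complex_inner)"
  by (metis cinner_scaleC_left scaleC_of_real)

lemma cinner_scaleR_right: "cinner x (r *\<^sub>R y) = of_real r * cinner x (y::'a::complex_inner)"
  by (metis cinner_scaleC_right scaleC_of_real complex_cnj_complex_of_real)

lemma cinner_diff_left: "cinner (x - y) z = cinner x z - cinner y (z::'a::complex_inner)"
  by (metis add_diff_cancel_right' cinner_add_left diff_add_cancel)

lemma Im_cinner: "Im (cinner x y) = inner ((- \<i>) *\<^sub>C x) (y::'a::complex_inner)"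
  by (simp add: inner_eq_Re_cinner cinner_scaleC_left)

lemma norm_scaleC: "norm (c *\<^sub>C x) = cmod c * norm (x::'a::complex_inner)"
proof -
  have im: "Im (cinner x x) = 0"
    using cinner_commute[of x x] by (metis Reals_cnj_iff complex_is_Real_iff)
  have "(norm (c *\<^sub>C x))\<^sup>2 = Re ((c * cnj c) * cinner x x)"
    by (simp add: power2_norm_eq_inner inner_eq_Re_cinner cinner_scaleC_left
        cinner_scaleC_right algebra_simps)
  also have "\<dots> = (cmod c)\<^sup>2 * Re (cinner x x)"
    using im by (simp add: complex_mult_cnj cmod_power2)
  also have "\<dots> = (cmod c * norm x)\<^sup>2"
    by (simp add: power_mult_distrib power2_norm_eq_inner inner_eq_Re_cinner)
  finally show ?thesis
    by (simp add: power2_eq_iff_nonneg)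
qed

lemma cmod_cinner_le: "cmod (cinner x y) \<le> norm x * norm (y::'a::complex_inner)"
proof -
  define c where "c = cnj (sgn (cinner x y))"
  have "cmod (cinner x y) = Re (c * cinner x y)"
  proof (cases "cinner x y = 0")
    case False
    have "c * cinner x y = (cinner x y * cnj (cinner x y)) / of_real (cmod (cinner x y))"
      by (simp add: c_def sgn_eq)
    also have "\<dots> = of_real (cmod (cinner x y))"
      using False by (simp add: power2_eq_square flip: complex_norm_square)
    finally show ?thesis by simp
  qed simp
  also have "\<dots> = inner (c *\<^sub>C x) y"
    by (simp add: inner_eq_Re_cinner cinner_scaleC_left)
  also have "\<dots> \<le> norm (c *\<^sub>C x) * norm y"
    by (rule norm_cauchy_schwarz)
  also have "\<dots> \<le> norm x * norm y"
    by (simp add: norm_scaleC c_def norm_sgn mult_right_mono)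
  finally show ?thesis .
qed

lemma riesz_real:
  fixes f :: "'a::{real_inner,complete_space} \<Rightarrow> real"
  assumes "bounded_linear f"
  shows "\<exists>a. \<forall>x. f x = inner x a"
proof (cases "\<forall>x. f x = 0")
  case True
  then show ?thesis by (intro exI[of _ 0]) simp
next
  case False
  interpret bounded_linear f by fact
  define S where "S = {x. f x = 1}"
  define d where "d = Inf ((\<lambda>x. (norm x)\<^sup>2) ` S)"
  from False obtain u where "f u \<noteq> 0" by blast
  then have "(1 / f u) *\<^sub>R u \<in> S" by (simp add: S_def scaleR)
  then have ne: "S \<noteq> {}" by blast
  have bdd: "bdd_below ((\<lambda>x. (norm x)\<^sup>2) ` S)" by (rule bdd_belowI[of _ 0]) auto
  have d_le: "d \<le> (norm x)\<^sup>2" if "x \<in> S" for x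
    unfolding d_def using that bdd by (intro cInf_lower) auto
  have "\<exists>x\<in>S. (norm x)\<^sup>2 < d + 1 / real (Suc n)" for n
  proof -
    have "d < d + 1 / real (Suc n)" by simp
    then show ?thesis
      using cInf_less_iff[of "(\<lambda>x. (norm x)\<^sup>2) ` S" "d + 1 / real (Suc n)"] ne bdd
      unfolding d_def by blast
  qed
  then obtain X where XS: "\<And>n. X n \<in> S"
    and X: "\<And>n. (norm (X n))\<^sup>2 < d + 1 / real (Suc n)" by metis
  have par: "(dist (X m) (X n))\<^sup>2 \<le> 2 / real (Suc m) + 2 / real (Suc n)" for m n
  proof -
    have "(1/2) *\<^sub>R (X m + X n) \<in> S" using XS[of m] XS[of n] by (simp add: S_def scaleR add)
    from d_le[OF this] have "4 * d \<le> (norm (X m + X n))\<^sup>2"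
      by (simp add: power_divide)
    moreover have "(norm (X m - X n))\<^sup>2 + (norm (X m + X n))\<^sup>2
        = 2 * (norm (X m))\<^sup>2 + 2 * (norm (X n))\<^sup>2"
      by (simp add: power2_norm_eq_inner algebra_simps inner_commute)
    ultimately show ?thesis using X[of m] X[of n] by (simp add: dist_norm)
  qed
  have "Cauchy X"
  proof (rule metric_CauchyI)
    fix e :: real assume "e > 0"
    then obtain N where N: "1 / real (Suc N) < e\<^sup>2 / 4"
      using nat_approx_posE[of "e\<^sup>2 / 4"] by auto
    have "dist (X m) (X n) < e" if "m \<ge> N" "n \<ge> N" for m n
    proof -
      have "1 / real (Suc m) \<le> 1 / real (Suc N)" "1 / real (Suc n) \<le> 1 / real (Suc N)"
        using that by (auto intro!: divide_left_mono)
      then have "(dist (X m) (X n))\<^sup>2 < e\<^sup>2"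
        using par[of m n] N by linarith
      then show ?thesis using \<open>e > 0\<close> by (simp add: power2_less_imp_less)
    qed
    then show "\<exists>M. \<forall>m\<ge>M. \<forall>n\<ge>M. dist (X m) (X n) < e" by blast
  qed
  then obtain z where z: "X \<longlonglongrightarrow> z" using Cauchy_convergent convergent_def by blast
  have "(\<lambda>n. f (X n)) \<longlonglongrightarrow> f z" by (rule tendsto[OF z])
  then have fz: "f z = 1" using XS by (simp add: S_def LIMSEQ_const_iff)
  have nz: "(norm z)\<^sup>2 \<le> d"
  proof (rule LIMSEQ_le)
    show "(\<lambda>n. (norm (X n))\<^sup>2) \<longlonglongrightarrow> (norm z)\<^sup>2" by (intro tendsto_intros z)
    show "(\<lambda>n. d + 1 / real (Suc n)) \<longlonglongrightarrow> d"
      using tendsto_add[OF tendsto_const LIMSEQ_Suc[OF lim_1_over_n], of d] by simp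
  qed (use X less_imp_le in blast)
  have z0: "z \<noteq> 0" using fz zero by auto
  have orth: "inner v z = 0" if "f v = 0" for v
  proof (rule ccontr)
    assume nv: "inner v z \<noteq> 0"
    then have vv: "inner v v > 0" by auto
    define t where "t = - inner v z / inner v v"
    have "z + t *\<^sub>R v \<in> S" using fz that by (simp add: S_def add scaleR)
    from d_le[OF this] nz have "(norm z)\<^sup>2 \<le> (norm (z + t *\<^sub>R v))\<^sup>2"
      by (rule order_trans[rotated])
    also have "\<dots> = (norm z)\<^sup>2 + 2 * t * inner v z + t\<^sup>2 * inner v v"
      unfolding power2_norm_eq_inner
      by (simp add: algebra_simps inner_commute power2_eq_square)
    also have "\<dots> = (norm z)\<^sup>2 - (inner v z)\<^sup>2 / inner v v"
      using vv by (simp add: t_def field_simps power2_eq_square)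
    finally show False using nv vv by (simp add: divide_le_0_iff)
  qed
  have "f x = inner x ((1 / (norm z)\<^sup>2) *\<^sub>R z)" for x
  proof -
    have "f (x - f x *\<^sub>R z) = 0" using fz by (simp add: diff scaleR)
    from orth[OF this] have "inner x z = f x * (norm z)\<^sup>2"
      by (simp add: inner_diff_left power2_norm_eq_inner)
    then show ?thesis using z0 by simp
  qed
  then show ?thesis by blast
qed

lemma cinner_right_eqI:
  fixes a b :: "'a::complex_inner"
  assumes "\<And>x. cinner x a = cinner x b"
  shows "a = b"
proof -
  have "inner (a - b) (a - b) = inner (a - b) a - inner (a - b) b"
    by (simp add: inner_diff_right)
  also have "\<dots> = 0" by (simp add: inner_eq_Re_cinner assms)
  finally show ?thesis by simp
qed

lemma cadjoint_exists1:
  fixes A :: "'a::chilbert_space \<Rightarrow> 'a"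
  assumes "bounded_clinear A"
  shows "\<exists>!B. \<forall>x y. cinner (A x) y = cinner x (B y)"
proof -
  interpret bounded_clinear A by fact
  have "\<exists>b. \<forall>x. inner (A x) y = inner x b" for y
    by (intro riesz_real bounded_linear_compose[OF bounded_linear_inner_left]
        bounded_linear_axioms)
  then obtain B where B: "\<And>x y. inner (A x) y = inner x (B y)" by metis
  have "cinner (A x) y = cinner x (B y)" for x y
    by (rule complex_eqI)
      (simp_all add: B Im_cinner flip: inner_eq_Re_cinner scaleC)
  moreover have "B' = B" if "\<forall>x y. cinner (A x) y = cinner x (B' y)" for B'
    using that calculation by (metis cinner_right_eqI ext)
  ultimately show ?thesis by blast
qed

lemma cinner_cadjoint:
  fixes A :: "'a::chilbert_space \<Rightarrow> 'a"
  assumes "bounded_clinear A"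
  shows "cinner (A x) y = cinner x (cadjoint A y)"
  using theI'[OF cadjoint_exists1[OF assms]] unfolding cadjoint_def by blast

lemma bounded_clinear_cadjoint:
  fixes A :: "'a::chilbert_space \<Rightarrow> 'a"
  assumes "bounded_clinear A"
  shows "bounded_clinear (cadjoint A)"
proof -
  interpret bounded_clinear A by fact
  note adj = cinner_cadjoint[OF assms, symmetric]
  obtain K where K: "K \<ge> 0" "\<And>x. norm (A x) \<le> norm x * K" using nonneg_bounded by blast
  have "norm (cadjoint A y) \<le> norm y * K" for y
  proof (cases "cadjoint A y = 0")
    case False
    have "(norm (cadjoint A y))\<^sup>2 = inner (A (cadjoint A y)) y"
      by (simp add: power2_norm_eq_inner inner_eq_Re_cinner adj)
    also have "\<dots> \<le> norm (A (cadjoint A y)) * norm y" by (rule norm_cauchy_schwarz)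
    also have "\<dots> \<le> norm (cadjoint A y) * K * norm y" by (intro mult_right_mono K) simp
    finally show ?thesis using False by (simp add: power2_eq_square mult.commute)
  qed (use K in simp)
  moreover have "cadjoint A (x + y) = cadjoint A x + cadjoint A y" for x y
    by (rule cinner_right_eqI) (simp add: adj cinner_add_right)
  moreover have "cadjoint A (r *\<^sub>R x) = r *\<^sub>R cadjoint A x" for r x
    by (rule cinner_right_eqI) (simp add: adj cinner_scaleR_right)
  moreover have "cadjoint A (c *\<^sub>C x) = c *\<^sub>C cadjoint A x" for c x
    by (rule cinner_right_eqI) (simp add: adj cinner_scaleC_right)
  ultimately show ?thesis by (intro bounded_clinear.intro bounded_linear_intro bounded_clinear_axioms.intro)
qed

lemma numerical_radius_bdd:
  assumes "bounded_linear X"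
  shows "bdd_above (insert 0 {cmod (cinner (X x) x) | x. norm x = 1})"
proof -
  obtain K where K: "\<And>x. norm (X x) \<le> norm x * K"
    using bounded_linear.bounded[OF assms] by blast
  have "cmod (cinner (X x) x) \<le> K" if "norm x = 1" for x
    using cmod_cinner_le[of "X x" x] K[of x] that by simp
  then have "\<forall>r \<in> insert 0 {cmod (cinner (X x) x) | x. norm x = 1}. r \<le> max 0 K"
    by force
  then show ?thesis unfolding bdd_above_def by blast
qed

lemma cmod_cinner_le_numerical_radius:
  assumes "bounded_linear X" "norm x = 1"
  shows "cmod (cinner (X x) x) \<le> numerical_radius X"
  unfolding numerical_radius_def using assms by (intro cSup_upper numerical_radius_bdd) auto

lemma numerical_radius_nonneg: "bounded_linear X \<Longrightarrow> 0 \<le> numerical_radius X"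
  unfolding numerical_radius_def by (intro cSup_upper numerical_radius_bdd) auto

text \<open>
  The integrand of the main statement is Lipschitz in \<open>t\<close>, so its integral is a genuine one.
\<close>

lemma numerical_radius_segment_integrable:
  fixes A :: "'a::chilbert_space \<Rightarrow> 'a"
  assumes "bounded_clinear A"
  shows "(\<lambda>t. numerical_radius (\<lambda>x. (1 - t) *\<^sub>R A x + t *\<^sub>R cadjoint A x))
    integrable_on {0..1}"
proof -
  interpret A: bounded_clinear A by fact
  interpret B: bounded_clinear "cadjoint A" by (rule bounded_clinear_cadjoint) fact
  define X where "X t = (\<lambda>x. (1 - t) *\<^sub>R A x + t *\<^sub>R cadjoint A x)" for t :: real
  have X: "bounded_linear (X t)" for t
    unfolding X_def
    by (intro bounded_linear_add bounded_linear_const_scaleR A.bounded_linear_axioms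
        B.bounded_linear_axioms)
  have "bounded_linear (\<lambda>x. cadjoint A x - A x)"
    by (intro bounded_linear_sub A.bounded_linear_axioms B.bounded_linear_axioms)
  then obtain K where K: "K \<ge> 0" "\<And>x. norm (cadjoint A x - A x) \<le> norm x * K"
    using bounded_linear.nonneg_bounded by blast
  have le: "numerical_radius (X s) \<le> numerical_radius (X t) + K * \<bar>s - t\<bar>" for s t
    unfolding numerical_radius_def[of "X s"]
  proof (rule cSup_least)
    fix r assume "r \<in> insert 0 {cmod (cinner (X s x) x) | x. norm x = 1}"
    then consider "r = 0" | x where "r = cmod (cinner (X s x) x)" "norm x = 1" by blast
    then show "r \<le> numerical_radius (X t) + K * \<bar>s - t\<bar>"
    proof cases
      case 1
      then show ?thesis using K numerical_radius_nonneg[OF X] by simp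
    next
      case 2
      have "X s x = X t x + (s - t) *\<^sub>R (cadjoint A x - A x)"
        by (simp add: X_def algebra_simps)
      then have "r \<le> cmod (cinner (X t x) x) + \<bar>s - t\<bar> * cmod (cinner (cadjoint A x - A x) x)"
        unfolding 2 using norm_triangle_ineq
        by (metis cinner_add_left cinner_scaleR_left norm_mult norm_of_real)
      moreover have "cmod (cinner (cadjoint A x - A x) x) \<le> K"
        using cmod_cinner_le[of "cadjoint A x - A x" x] K(2)[of x] 2 by simp
      ultimately show ?thesis
        using cmod_cinner_le_numerical_radius[OF X 2(2), of t]
          mult_left_mono[of "cmod (cinner (cadjoint A x - A x) x)" K "\<bar>s - t\<bar>"]
        by (simp add: mult.commute)
    qed
  qed simp
  have "K-lipschitz_on {0..1} (\<lambda>t. numerical_radius (X t))"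
  proof (rule lipschitz_onI)
    show "dist (numerical_radius (X s)) (numerical_radius (X t)) \<le> K * dist s t" for s t
      using le[of s t] le[of t s] by (simp add: dist_real_def abs_le_iff abs_minus_commute)
  qed fact
  then show ?thesis
    unfolding X_def by (intro integrable_continuous_interval lipschitz_on_continuous_on)
qed

end

theory Submission
  imports Defs
begin

text \<open>
  For a unit vector \<open>x\<close> put \<open>z = \<langle>A x, x\<rangle>\<close>. Then \<open>\<langle>((1 - t) A + t A\<^sup>*) x, x\<rangle> = (1 - t) z + t z\<^sup>*\<close>
  has modulus at most \<open>\<bar>z\<bar>\<close> and real part \<open>Re z = \<langle>(\<Re> A) x, x\<rangle>\<close>. Since the norm of the
  symmetric operator \<open>\<Re> A\<close> is determined by its quadratic form, the integrand lies between
  \<open>\<parallel>\<Re> A\<parallel>\<close> and \<open>\<omega>(A)\<close> at every \<open>t\<close>.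
\<close>

text \<open>Symmetry allows polarization: \<open>inner (H x) y\<close> is a difference of two values
  of the quadratic form, and the parallelogram law adds up their bounds.\<close>

lemma onorm_le_quadratic_form:
  fixes H :: "'a::real_inner \<Rightarrow> 'a"
  assumes lin: "linear H"
    and c: "0 \<le> c"
    and sym: "\<And>x y. inner (H x) y = inner x (H y)"
    and le: "\<And>x. \<bar>inner (H x) x\<bar> \<le> c * (norm x)\<^sup>2"
  shows "onorm H \<le> c"
proof (rule onorm_bound[OF c])
  fix x
  interpret linear H by fact
  show "norm (H x) \<le> c * norm x"
  proof (cases "H x = 0 \<or> x = 0")
    case True
    then show ?thesis using c zero by auto
  next
    case False
    \<comment> \<open>Rescaling \<open>H x\<close> to the length of \<open>x\<close> makes
      \<open>inner (H x) y\<close> equal \<open>norm x * norm (H x)\<close>, while the parallelogram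
      sum becomes \<open>4 * (norm x)\<^sup>2\<close>, which cancels the factor 4 of
      polarization.\<close>
    define y where "y = (norm x / norm (H x)) *\<^sub>R H x"
    have ny: "norm y = norm x" using False by (simp add: y_def)
    have "4 * inner (H x) y = inner (H (x + y)) (x + y) - inner (H (x - y)) (x - y)"
      using sym[of x y] by (simp add: add diff algebra_simps inner_commute)
    also have "\<dots> \<le> c * (norm (x + y))\<^sup>2 + c * (norm (x - y))\<^sup>2"
      using le[of "x + y"] le[of "x - y"] by linarith
    also have "\<dots> = c * (2 * (norm x)\<^sup>2 + 2 * (norm y)\<^sup>2)"
      by (simp add: power2_norm_eq_inner algebra_simps inner_commute)
    finally have "inner (H x) y \<le> c * (norm x)\<^sup>2" by (simp add: ny)
    moreover have "inner (H x) y = norm x * norm (H x)"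
      using False by (simp add: y_def power2_eq_square flip: power2_norm_eq_inner)
    ultimately have "norm x * norm (H x) \<le> norm x * (c * norm x)"
      by (simp add: power2_eq_square mult_ac)
    then show ?thesis using False by simp
  qed
qed

context
  fixes A :: "'a::chilbert_space \<Rightarrow> 'a"
  assumes A: "bounded_clinear A"
begin

lemma bounded_linear_segment:
  "bounded_linear (\<lambda>x. (1 - t) *\<^sub>R A x + t *\<^sub>R cadjoint A x)"
  using A bounded_clinear_cadjoint[OF A]
  by (intro bounded_linear_add bounded_linear_const_scaleR bounded_clinear.axioms(1))

lemma cinner_cadjoint_left: "cinner (cadjoint A x) y = cinner x (A y)"
  by (metis A cinner_cadjoint cinner_commute)

text \<open>Passing to the adjoint conjugates the quadratic form, so both bounds on the integrand
  reduce to arithmetic with one complex number.\<close>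

lemma cinner_segment:
  "cinner ((1 - t) *\<^sub>R A x + t *\<^sub>R cadjoint A x) x
    = of_real (1 - t) * cinner (A x) x + of_real t * cnj (cinner (A x) x)"
  by (simp add: cinner_add_left cinner_scaleR_left cinner_cadjoint_left flip: cinner_commute)

lemma numerical_radius_segment_le:
  assumes "0 \<le> t" "t \<le> 1"
  shows "numerical_radius (\<lambda>x. (1 - t) *\<^sub>R A x + t *\<^sub>R cadjoint A x) \<le> numerical_radius A"
proof -
  have "cmod (cinner ((1 - t) *\<^sub>R A x + t *\<^sub>R cadjoint A x) x) \<le> numerical_radius A"
    if "norm x = 1" for x
  proof -
    have "cmod (cinner ((1 - t) *\<^sub>R A x + t *\<^sub>R cadjoint A x) x)
        \<le> (1 - t) * cmod (cinner (A x) x) + t * cmod (cinner (A x) x)"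
      unfolding cinner_segment using assms
      by (intro norm_triangle_le) (simp add: norm_mult del: of_real_diff)
    also have "\<dots> = cmod (cinner (A x) x)" by (simp add: algebra_simps)
    also have "\<dots> \<le> numerical_radius A"
      using A that by (intro cmod_cinner_le_numerical_radius bounded_clinear.axioms(1))
    finally show ?thesis .
  qed
  \<comment> \<open>Nonnegativity covers the extra element \<open>0\<close> in the supremum.\<close>
  then show ?thesis
    using numerical_radius_nonneg[OF bounded_clinear.axioms(1)[OF A]]
    by (subst numerical_radius_def, intro cSup_least) auto
qed

lemma inner_real_part: "inner (real_part A x) y = inner x (real_part A y)"
  by (simp add: real_part_def inner_eq_Re_cinner cinner_scaleR_left cinner_scaleR_right
      cinner_add_left cinner_add_right cinner_cadjoint_left cinner_cadjoint[OF A])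

text \<open>Conjugation fixes real parts, so the real part of the segment's quadratic form does not
  depend on \<open>t\<close>; hence the bound holds for every real \<open>t\<close>.\<close>

lemma onorm_real_part_le_numerical_radius_segment:
  "onorm (real_part A) \<le> numerical_radius (\<lambda>x. (1 - t) *\<^sub>R A x + t *\<^sub>R cadjoint A x)"
    (is "_ \<le> ?w")
proof (rule onorm_le_quadratic_form)
  \<comment> \<open>\<open>real_part A\<close> is the midpoint of the segment.\<close>
  have "bounded_linear (real_part A)"
    using bounded_linear_segment[of "1 / 2"] by (simp add: real_part_def scaleR_right_distrib)
  then show lin: "linear (real_part A)" by (rule bounded_linear.linear)
  show "0 \<le> ?w" using bounded_linear_segment by (rule numerical_radius_nonneg)
  have unit: "\<bar>inner (real_part A x) x\<bar> \<le> ?w" if "norm x = 1" for x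
  proof -
    have "inner (real_part A x) x = Re (cinner (A x) x)"
      using cinner_segment[of "1 / 2" x]
      by (simp add: real_part_def inner_eq_Re_cinner scaleR_right_distrib)
    also have "\<dots> = Re (cinner ((1 - t) *\<^sub>R A x + t *\<^sub>R cadjoint A x) x)"
      unfolding cinner_segment by (simp add: algebra_simps)
    finally have "\<bar>inner (real_part A x) x\<bar>
        \<le> cmod (cinner ((1 - t) *\<^sub>R A x + t *\<^sub>R cadjoint A x) x)"
      using abs_Re_le_cmod by metis
    also have "\<dots> \<le> ?w"
      using cmod_cinner_le_numerical_radius[OF bounded_linear_segment that] .
    finally show ?thesis .
  qed
  show "\<bar>inner (real_part A x) x\<bar> \<le> ?w * (norm x)\<^sup>2" for x
  proof (cases "x = 0")
    case False
    \<comment> \<open>Homogeneity of degree two reduces the bound to the unit vector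
      \<open>sgn x\<close>.\<close>
    have "inner (real_part A x) x = (norm x)\<^sup>2 * inner (real_part A (sgn x)) (sgn x)"
      using False
      by (simp add: sgn_div_norm linear_scale[OF lin] power2_eq_square field_simps)
    then show ?thesis
      using mult_left_mono[OF unit[of "sgn x"], of "(norm x)\<^sup>2"] False
      by (simp add: norm_sgn abs_mult mult.commute)
  qed simp
qed (rule inner_real_part)

end

theorem corollary2p1:
  fixes A :: "'a::chilbert_space \<Rightarrow> 'a"
  assumes "bounded_clinear A"
  shows "onorm (real_part A)
      \<le> integral {0..1} (\<lambda>t. numerical_radius (\<lambda>x. (1 - t) *\<^sub>R A x + t *\<^sub>R cadjoint A x))
    \<and> integral {0..1} (\<lambda>t. numerical_radius (\<lambda>x. (1 - t) *\<^sub>R A x + t *\<^sub>R cadjoint A x))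
      \<le> numerical_radius A"
  (is "_ \<le> integral _ ?f \<and> _")
proof
  note int = numerical_radius_segment_integrable[OF assms]
  \<comment> \<open>The interval has length 1, so constants integrate to themselves.\<close>
  have "integral {0..1::real} (\<lambda>_. onorm (real_part A)) \<le> integral {0..1} ?f"
    using onorm_real_part_le_numerical_radius_segment[OF assms]
    by (intro integral_le int) auto
  then show "onorm (real_part A) \<le> integral {0..1} ?f" by simp
  have "integral {0..1} ?f \<le> integral {0..1::real} (\<lambda>_. numerical_radius A)"
    using numerical_radius_segment_le[OF assms]
    by (intro integral_le int) auto
  then show "integral {0..1} ?f \<le> numerical_radius A" by simp
qed

end
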